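(* Let $m\ge 2$ be an integer. Then $$|\mathcal{V}_m|\le\sum_{k=1}^m\phi(k)\quad\text{and}\quad |\mathcal{Y}_m|=|\widetilde{\mathcal{Y}_m}|\le m\sum_{k=1}^{m-1}\phi(k).$$
   Context: $[m]=\{1,\dots,m\}$ and $\mathfrak{S}_m$ is the set of all bijections $[m]\to[m]$. For a predicate $P$, $\mathbf{1}(P)=1$ if $P$ is true and $0$ if $P$ is false. $\phi$ is Euler's totient function (with $\phi(1)=1$). For $m\ge 2$: $$\mathcal{V}_m=\{\theta\in\mathfrak{S}_m:\ \theta(i+1)-\theta(i)\equiv\theta(1)-\mathbf{1}(\theta(m)\le\theta(i)) \pmod m\ \text{ for all } i\in[m-1]\}.$$ For $\theta\in\mathfrak{S}_m$ and $i\in[m-1]$ put $$\Delta_\theta(i)=\theta(i+1)-\theta(i)+\mathbf{1}(\theta(m)\le\theta(i))-\mathbf{1}(\theta(1)\le\theta(i+1))-(m-1)\mathbf{1}(\theta(i)\le\theta(i+1)).$$ For $m\ge 3$, $\mathcal{Y}_m=\{\theta\in\mathfrak{S}_m:\ \Delta_\theta(i+1)-\Delta_\theta(i)=0\ \text{ for all } i\in[m-2]\}$, and $\mathcal{Y}_2=\mathfrak{S}_2$. For $\theta,\theta'\in\mathfrak{S}_m$ write $\theta\sim\theta'$ (shift-equivalent) if there is $k\in[m]$ with $\theta'(i)\equiv\theta(i)+k\pmod m$ for all $i\in[m]$. For $T\subset\mathfrak{S}_m$, the shift-closure is $\widetilde{T}=\{\theta'\in\mathfrak{S}_m:\ \exists\,\theta\in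 T,\ \theta\sim\theta'\}$. *)

theory Defs
  imports "HOL-Number_Theory.Number_Theory" "HOL-Combinatorics.Permutations"
begin

text \<open>
  Bijections of \<open>[m] = {1..m}\<close> are represented as functions on \<open>nat\<close> that permute \<open>{1..m}\<close>.
  Since \<open>permutes\<close> requires the identity outside of \<open>{1..m}\<close>, each bijection has
  exactly one representative, so cardinalities are the intended ones.
  Differences of values are taken in \<open>int\<close>.
\<close>

definition Sym :: "nat \<Rightarrow> (nat \<Rightarrow> nat) set" where
  "Sym m = {\<theta>. \<theta> permutes {1..m}}"

definition V :: "nat \<Rightarrow> (nat \<Rightarrow> nat) set" where
  "V m = {\<theta> \<in> Sym m. \<forall>i\<in>{1..m - 1}.
     [int (\<theta> (i + 1)) - int (\<theta> i) = int (\<theta> 1) - of_bool (\<theta> m \<le> \<theta> i)] (mod int m)}"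

definition Delta :: "nat \<Rightarrow> (nat \<Rightarrow> nat) \<Rightarrow> nat \<Rightarrow> int" where
  "Delta m \<theta> i = int (\<theta> (i + 1)) - int (\<theta> i)
     + of_bool (\<theta> m \<le> \<theta> i) - of_bool (\<theta> 1 \<le> \<theta> (i + 1))
     - (int m - 1) * of_bool (\<theta> i \<le> \<theta> (i + 1))"

text \<open>
  For \<open>m = 2\<close> the condition below is vacuous, which gives the convention \<open>Y 2 = Sym 2\<close>
  (see \<open>Y_2\<close>).
\<close>

definition Y :: "nat \<Rightarrow> (nat \<Rightarrow> nat) set" where
  "Y m = {\<theta> \<in> Sym m. \<forall>i\<in>{1..m - 2}. Delta m \<theta> (i + 1) - Delta m \<theta> i = 0}"

lemma Y_2: "Y 2 = Sym 2"
  by (simp add: Y_def)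

definition shift_equiv :: "nat \<Rightarrow> (nat \<Rightarrow> nat) \<Rightarrow> (nat \<Rightarrow> nat) \<Rightarrow> bool" where
  "shift_equiv m \<theta> \<theta>' \<longleftrightarrow> (\<exists>k\<in>{1..m}. \<forall>i\<in>{1..m}. [\<theta>' i = \<theta> i + k] (mod m))"

definition shift_closure :: "nat \<Rightarrow> (nat \<Rightarrow> nat) set \<Rightarrow> (nat \<Rightarrow> nat) set" where
  "shift_closure m T = {\<theta>' \<in> Sym m. \<exists>\<theta>\<in>T. shift_equiv m \<theta> \<theta>'}"

end

theory Submission
  imports Defs
begin

text \<open>
  Place \<open>n + 1\<close> indices on the circle \<open>\<int>/(n + 1)\<close> so that the cyclic order of the first \<open>n\<close>
  of them is carried by \<open>i \<mapsto> i + 1\<close> to the cyclic order of the last \<open>n\<close>. If \<open>N i\<close> is the index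
  following \<open>i\<close> on the circle, then \<open>N (i + 1) = N i + 1\<close> except where index \<open>n\<close> or index \<open>0\<close>
  interferes, so \<open>N\<close> is determined by the two neighbours \<open>u, v\<close> of index \<open>0\<close> (the three gap
  phenomenon). One gets \<open>u + v > n\<close> from injectivity of \<open>N\<close>, and \<open>coprime u v\<close> because \<open>N\<close>
  preserves residues modulo \<open>gcd u v\<close> but has a single orbit. As for consecutive denominators of a
  Farey sequence, there are \<open>\<phi>(1) + \<dots> + \<phi>(n)\<close> such pairs.

  A member of \<open>V m\<close> together with \<open>\<theta> 0 = 0\<close> is such a configuration with \<open>n = m\<close>. A member of
  \<open>Y m\<close> is one with \<open>n = m - 1\<close>, up to the position of its first point. The set \<open>Y m\<close> is closed under
  shifts because constancy of \<open>Delta\<close> is equivalent to constancy modulo \<open>m - 1\<close>.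
\<close>

section \<open>Counting coprime pairs with large sum\<close>

definition coprime_pairs :: "nat \<Rightarrow> (nat \<times> nat) set" where
  "coprime_pairs n = {(u, v). u \<in> {1..n} \<and> v \<in> {1..n} \<and> coprime u v \<and> n < u + v}"

lemma finite_coprime_pairs: "finite (coprime_pairs n)"
  by (rule finite_subset[of _ "{1..n} \<times> {1..n}"]) (auto simp: coprime_pairs_def)

text \<open>Raising the bound discards the pairs of sum exactly \<open>n + 1\<close>
  (\<open>C\<close>) and admits those with a component \<open>n + 1\<close> (\<open>A\<close> and
  \<open>B\<close>). Each of these three sets is a copy of the totatives of \<open>n + 1\<close>, so
  the net gain is one totient.\<close>

lemma card_coprime_pairs_Suc:
  assumes "n \<ge> 1"
  shows "card (coprime_pairs (Suc n)) = card (coprime_pairs n) + totient (Suc n)"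
proof -
  let ?T = "totatives (Suc n)"
  define A where "A = (\<lambda>u. (u, Suc n)) ` ?T"
  define B where "B = (\<lambda>v. (Suc n, v)) ` ?T"
  define C where "C = (\<lambda>u. (u, Suc n - u)) ` ?T"
  \<comment> \<open>As \<open>n + 1 > 1\<close> is not coprime to itself, it is not among its own
    totatives.\<close>
  have T: "?T = {u. 0 < u \<and> u \<le> n \<and> coprime u (Suc n)}"
    using assms by (auto simp: totatives_def le_Suc_eq)
  have sum_coprime: "coprime u (u + v) \<longleftrightarrow> coprime u v" for u v :: nat
    unfolding coprime_iff_gcd_eq_1 by (simp only: gcd_add2)
  have memC: "(u, v) \<in> C \<longleftrightarrow> (u, v) \<in> coprime_pairs n \<and> u + v = Suc n" for u v
  proof
    assume "(u, v) \<in> C"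
    then have u: "0 < u" "u \<le> n" "coprime u (Suc n)" and v: "v = Suc n - u"
      unfolding C_def T by blast+
    from u v have s: "Suc n = u + v" and "1 \<le> v" "v \<le> n" by linarith+
    have "coprime u v" using u(3) unfolding s sum_coprime .
    then show "(u, v) \<in> coprime_pairs n \<and> u + v = Suc n"
      using u s \<open>1 \<le> v\<close> \<open>v \<le> n\<close> by (simp add: coprime_pairs_def)
  next
    assume *: "(u, v) \<in> coprime_pairs n \<and> u + v = Suc n"
    then have "coprime u (u + v)" unfolding sum_coprime by (simp add: coprime_pairs_def)
    then have "u \<in> ?T" using * by (simp add: T coprime_pairs_def)
    moreover have "v = Suc n - u" using * by linarith
    ultimately show "(u, v) \<in> C" unfolding C_def by blast
  qed
  have memA: "(u, v) \<in> A \<longleftrightarrow> v = Suc n \<and> 0 < u \<and> u \<le> n \<and> coprime u (Suc n)" for u v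
    unfolding A_def T by blast
  have memB: "(u, v) \<in> B \<longleftrightarrow> u = Suc n \<and> 0 < v \<and> v \<le> n \<and> coprime v (Suc n)" for u v
    unfolding B_def T by blast
  have "(u, v) \<in> coprime_pairs (Suc n) \<longleftrightarrow> (u, v) \<in> (coprime_pairs n - C) \<union> (A \<union> B)" for u v
  proof -
    consider "u \<le> n" "v \<le> n" | "u = Suc n" | "v = Suc n" | "Suc n < u \<or> Suc n < v"
      by linarith
    then show ?thesis
    proof cases
      case 1
      then show ?thesis by (auto simp: memA memB memC coprime_pairs_def)
    next
      case 2
      then show ?thesis using assms
        by (cases "v = Suc n") (auto simp: memA memB coprime_pairs_def coprime_commute)
    next
      case 3
      then show ?thesis using assms
        by (cases "u = Suc n") (auto simp: memA memB coprime_pairs_def)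
    next
      case 4
      then show ?thesis by (auto simp: memA memB coprime_pairs_def)
    qed
  qed
  then have eq: "coprime_pairs (Suc n) = (coprime_pairs n - C) \<union> (A \<union> B)"
    by auto
  have C: "C \<subseteq> coprime_pairs n" using memC by auto
  have cards: "card A = totient (Suc n)" "card B = totient (Suc n)" "card C = totient (Suc n)"
    by (auto simp: A_def B_def C_def totient_def intro!: card_image inj_onI)
  have fin: "finite A" "finite B" "finite C"
    by (auto simp: A_def B_def C_def)
  have "A \<inter> B = {}" by (auto simp: memA memB)
  then have "card (A \<union> B) = 2 * totient (Suc n)"
    using cards fin by (simp add: card_Un_disjoint)
  moreover have "(coprime_pairs n - C) \<inter> (A \<union> B) = {}"
    by (auto simp: coprime_pairs_def A_def B_def)
  ultimately have "card (coprime_pairs (Suc n))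
      = card (coprime_pairs n - C) + 2 * totient (Suc n)"
    using fin finite_coprime_pairs[of n] by (simp add: eq card_Un_disjoint)
  moreover have "card (coprime_pairs n - C) = card (coprime_pairs n) - totient (Suc n)"
    using C cards fin by (simp add: card_Diff_subset)
  moreover have "totient (Suc n) \<le> card (coprime_pairs n)"
    using card_mono[OF finite_coprime_pairs C] cards by simp
  ultimately show ?thesis by simp
qed

lemma card_coprime_pairs:
  assumes "n \<ge> 1"
  shows "card (coprime_pairs n) = (\<Sum>k=1..n. totient k)"
  using assms
proof (induction n rule: dec_induct)
  case base
  have "coprime_pairs 1 = {(1, 1)}" by (auto simp: coprime_pairs_def)
  then show ?case by simp
next
  case (step n)
  then show ?case using card_coprime_pairs_Suc[of n] by simp
qed

section \<open>The three gap recursion\<close>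

text \<open>\<open>N\<close> rises by \<open>1\<close> on at most three runs of indices: one from
  value \<open>N 0\<close> up to \<open>n\<close>, a middle one, and one starting with value
  \<open>0\<close> at \<open>v\<close>. By injectivity the middle run has to fit between the values
  used by the other two.\<close>

lemma three_gap_successor:
  fixes N :: "nat \<Rightarrow> nat"
  assumes inj: "inj_on N {..n}"
    and le: "\<And>i. i \<le> n \<Longrightarrow> N i \<le> n"
    and step: "\<And>i. \<lbrakk>i < n; N i < n; N (Suc i) \<noteq> 0\<rbrakk> \<Longrightarrow> N (Suc i) = Suc (N i)"
    and v: "N v = 0" "v \<le> n" "0 < v"
  shows "n < N 0 + v"
    and "i \<le> n \<Longrightarrow> N i = (if i + N 0 \<le> n then i + N 0 else if v \<le> i then i - v else i + N 0 - v)"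
proof -
  define u where "u = N 0"
  have nz: "N i \<noteq> 0" if "i \<le> n" "i \<noteq> v" for i
    using inj_onD[OF inj, of i v] that v by auto
  have low: "N i = i + u" if "i < v" "i + u \<le> n" for i
    using that
  proof (induction i)
    case (Suc i)
    then show ?case using step[of i] nz[of "Suc i"] v by auto
  qed (simp add: u_def)
  have high: "N (v + j) = j" if "v + j \<le> n" for j
    using that
  proof (induction j)
    case (Suc j)
    then show ?case using step[of "v + j"] nz[of "Suc (v + j)"] v by auto
  qed (simp add: v)
  have uv: "n < u + v"
  proof (rule ccontr)
    assume "\<not> n < u + v"
    then have "N (v + u) = N 0" using high[of u] by (simp add: u_def)
    then show False using inj_onD[OF inj, of "v + u" 0] \<open>\<not> n < u + v\<close> v by auto
  qed
  then show "n < N 0 + v" by (simp add: u_def)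
  assume i: "i \<le> n"
  have un: "u \<le> n" "0 < u" using le[of 0] nz[of 0] v by (auto simp: u_def)
  show "N i = (if i + N 0 \<le> n then i + N 0 else if v \<le> i then i - v else i + N 0 - v)"
  proof (cases "i + u \<le> n \<or> v \<le> i")
    case True
    then show ?thesis using low[of i] high[of "i - v"] uv i by (auto simp: u_def)
  next
    case False
    \<comment> \<open>First index of the middle run. Its predecessor already takes the value
      \<open>n\<close>, so the run avoids \<open>n\<close> and \<open>step\<close> keeps
      applying.\<close>
    define e where "e = Suc (n - u)"
    have top: "N (n - u) = n" using low[of "n - u"] uv un by auto
    have mid: "N (e + j) = N e + j" if "e + j < v" for j
      using that
    proof (induction j)
      case (Suc j)
      have "N (e + j) \<noteq> N (n - u)"
        using inj_onD[OF inj, of "e + j" "n - u"] Suc.prems v by (auto simp: e_def)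
      then have "N (e + j) < n" using le[of "e + j"] top Suc.prems v by auto
      then show ?case using Suc step[of "e + j"] nz[of "Suc (e + j)"] v by auto
    qed simp
    have "e < v" using False un by (auto simp: e_def)
    have lower: "n - v < N e"
    proof (rule ccontr)
      assume *: "\<not> n - v < N e"
      then have le: "v + N e \<le> n" using v by linarith
      then have "N (v + N e) = N e" by (rule high)
      then show False using inj_onD[OF inj, of "v + N e" e] le \<open>e < v\<close> v by auto
    qed
    have upper: "N (v - 1) < u"
    proof (rule ccontr)
      assume *: "\<not> N (v - 1) < u"
      have "N (v - 1) \<le> n" using le[of "v - 1"] v by auto
      then have "N (N (v - 1) - u) = N (v - 1)"
        using low[of "N (v - 1) - u"] * uv by auto
      then have "N (v - 1) - u = v - 1"
        using inj_onD[OF inj, of "N (v - 1) - u" "v - 1"] \<open>N (v - 1) \<le> n\<close> v by auto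
      then show False using \<open>N (v - 1) \<le> n\<close> \<open>e < v\<close> e_def by linarith
    qed
    have "N (v - 1) = N e + (v - 1 - e)" using mid[of "v - 1 - e"] \<open>e < v\<close> by auto
    \<comment> \<open>The run is exactly as long as the list of values strictly between
      \<open>n - v\<close> and \<open>u\<close>, so both bounds are attained.\<close>
    then have "N e = Suc (n - v)"
      using lower upper \<open>e < v\<close> un v uv e_def by linarith
    moreover have "N i = N e + (i - e)"
    proof -
      have "e + (i - e) = i" using False un e_def by linarith
      then show ?thesis using mid[of "i - e"] False by simp
    qed
    ultimately show ?thesis using False un v i uv by (auto simp: u_def e_def)
  qed
qed

section \<open>Rotations between circles with one point deleted\<close>

text \<open>
  Subtracting \<open>of_bool (b \<le> x)\<close> renumbers the circle after deletion of the point \<open>b\<close>. The condition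
  thus says that \<open>i \<mapsto> i + 1\<close> is a rotation from the circle without \<open>p n\<close> to the circle without \<open>p 0\<close>.
\<close>

definition rotational :: "nat \<Rightarrow> (nat \<Rightarrow> nat) \<Rightarrow> bool" where
  "rotational n p \<longleftrightarrow> bij_betw p {..n} {..n} \<and>
     (\<exists>c::int. \<forall>i<n. [int (p (Suc i)) - of_bool (p 0 \<le> p (Suc i))
        = int (p i) - of_bool (p n \<le> p i) + c] (mod int n))"

definition cyc_next :: "nat \<Rightarrow> (nat \<Rightarrow> nat) \<Rightarrow> nat \<Rightarrow> nat" where
  "cyc_next n p i = inv_into {..n} p (Suc (p i) mod Suc n)"

text \<open>Adding \<open>n\<close> subtracts \<open>1\<close> modulo \<open>n + 1\<close> without
  truncation.\<close>

definition cyc_prev :: "nat \<Rightarrow> (nat \<Rightarrow> nat) \<Rightarrow> nat \<Rightarrow> nat" where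
  "cyc_prev n p i = inv_into {..n} p ((p i + n) mod Suc n)"

text \<open>Used with \<open>a = p 0\<close>, \<open>b = p n\<close>, neighbours
  \<open>x = p i\<close>, \<open>z = p j\<close> and their images \<open>y = p (i + 1)\<close>,
  \<open>w = p (j + 1)\<close>. Neighbours stay neighbours when another point \<open>b\<close> is
  deleted, the rotation preserves this, and after \<open>a\<close> is reinserted only
  \<open>a\<close> can separate \<open>y\<close> from \<open>w\<close>.\<close>

lemma rotation_step:
  fixes a b x y z w n :: nat and c :: int
  assumes n: "n \<ge> 1" and le: "a \<le> n" "b \<le> n" "x \<le> n" "y \<le> n" "w \<le> n"
    and ne: "x \<noteq> b" "z \<noteq> b" "y \<noteq> a" "w \<noteq> a"
    and z: "z = Suc x mod Suc n"
    and xy: "[int y - of_bool (a \<le> y) = int x - of_bool (b \<le> x) + c] (mod int n)"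
    and zw: "[int w - of_bool (a \<le> w) = int z - of_bool (b \<le> z) + c] (mod int n)"
  shows "w = Suc y mod Suc n \<or> a = Suc y mod Suc n"
proof -
  have "[int z - of_bool (b \<le> z) = int x - of_bool (b \<le> x) + 1] (mod int n)"
  proof (cases "x = n")
    case True
    then have "z = 0" using z by simp
    then show ?thesis using True le ne by (auto simp: cong_def)
  next
    case False
    then have "z = Suc x" using z le by simp
    then show ?thesis using ne by (auto simp: add.commute)
  qed
  then have "[int w - of_bool (a \<le> w) = int x - of_bool (b \<le> x) + 1 + c] (mod int n)"
    by (intro cong_trans[OF zw] cong_add cong_refl)
  also have "int x - of_bool (b \<le> x) + 1 + c = int x - of_bool (b \<le> x) + c + 1"
    by simp
  also have "[int x - of_bool (b \<le> x) + c + 1 = int y - of_bool (a \<le> y) + 1] (mod int n)"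
    by (intro cong_add cong_refl cong_sym[OF xy])
  finally have wy: "[int w - of_bool (a \<le> w) = int y - of_bool (a \<le> y) + 1] (mod int n)" .
  define w' where "w' = int w - of_bool (a \<le> w)"
  define y' where "y' = int y - of_bool (a \<le> y)"
  \<comment> \<open>Since \<open>w\<close> and \<open>y\<close> differ from \<open>a\<close>, the
    renumbered values are least residues modulo \<open>n\<close>, which turns the congruence into an
    equation.\<close>
  have bounds: "0 \<le> w'" "w' < int n" "0 \<le> y'" "y' < int n"
    using le ne by (auto simp: w'_def y'_def)
  have w': "w' = (y' + 1) mod int n"
    using wy bounds by (auto simp: cong_def w'_def[symmetric] y'_def[symmetric])
  show ?thesis
  proof (cases "y' + 1 = int n")
    case True
    with w' have "w' = 0" by simp
    then show ?thesis using True le ne n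
      by (cases "y = n") (auto simp: w'_def y'_def of_bool_def split: if_splits)
  next
    case False
    with w' bounds have "w' = y' + 1" by auto
    then show ?thesis using le ne n
      by (cases "y = n") (auto simp: w'_def y'_def of_bool_def split: if_splits)
  qed
qed

context
  fixes n :: nat and p :: "nat \<Rightarrow> nat"
  assumes n: "n \<ge> 1" and rot: "rotational n p"
begin

lemma rotational_bij: "bij_betw p {..n} {..n}"
  using rot by (simp add: rotational_def)

lemma rotational_le: "i \<le> n \<Longrightarrow> p i \<le> n"
  using rotational_bij by (auto simp: bij_betw_def)

lemma rotational_inv:
  assumes "x \<le> n"
  shows "inv_into {..n} p x \<le> n" "p (inv_into {..n} p x) = x"
  using rotational_bij assms
  by (metis atMost_iff bij_betw_imp_surj_on inv_into_into, 
      metis atMost_iff bij_betw_imp_surj_on f_inv_into_f)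

lemma cyc_next_le: "cyc_next n p i \<le> n"
  by (simp add: cyc_next_def rotational_inv(1))

lemma p_cyc_next: "p (cyc_next n p i) = Suc (p i) mod Suc n"
  by (simp add: cyc_next_def rotational_inv(2))

lemma cyc_prev_le: "cyc_prev n p i \<le> n"
  by (simp add: cyc_prev_def rotational_inv(1))

lemma p_cyc_prev: "p (cyc_prev n p i) = (p i + n) mod Suc n"
  by (simp add: cyc_prev_def rotational_inv(2))

lemma rotational_eqD: "\<lbrakk>p i = p j; i \<le> n; j \<le> n\<rbrakk> \<Longrightarrow> i = j"
  using rotational_bij by (auto simp: bij_betw_def inj_on_def)

lemma cyc_next_ne: "i \<le> n \<Longrightarrow> cyc_next n p i \<noteq> i"
  using p_cyc_next[of i] rotational_le[of i] n by (cases "p i = n") auto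

lemma cyc_next_inj: "inj_on (cyc_next n p) {..n}"
proof (rule inj_onI)
  fix i j assume *: "i \<in> {..n}" "j \<in> {..n}" "cyc_next n p i = cyc_next n p j"
  then have "Suc (p i) mod Suc n = Suc (p j) mod Suc n"
    by (metis p_cyc_next)
  moreover have "p i \<le> n" "p j \<le> n" using * rotational_le by auto
  ultimately have "p i = p j"
    by (cases "p i = n"; cases "p j = n") auto
  then show "i = j" using rotational_eqD * by auto
qed

lemma cyc_next_prev: "i \<le> n \<Longrightarrow> cyc_next n p (cyc_prev n p i) = i"
proof (rule rotational_eqD)
  assume "i \<le> n"
  then show "p (cyc_next n p (cyc_prev n p i)) = p i"
    using rotational_le[of i] by (simp add: p_cyc_next p_cyc_prev mod_Suc_eq flip: add_Suc_right)
qed (auto simp: cyc_next_le)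

text \<open>\<open>rotation_step\<close> leaves two candidates for the point after
  \<open>p (Suc i)\<close>; the last hypothesis excludes \<open>p 0\<close>.\<close>

lemma cyc_next_Suc:
  assumes "i < n" "cyc_next n p i < n" "cyc_next n p (Suc i) \<noteq> 0"
  shows "cyc_next n p (Suc i) = Suc (cyc_next n p i)"
proof -
  define j where "j = cyc_next n p i"
  obtain c :: int where c: "\<And>i. i < n \<Longrightarrow> [int (p (Suc i)) - of_bool (p 0 \<le> p (Suc i))
        = int (p i) - of_bool (p n \<le> p i) + c] (mod int n)"
    using rot by (auto simp: rotational_def)
  have "p (Suc j) = Suc (p (Suc i)) mod Suc n \<or> p 0 = Suc (p (Suc i)) mod Suc n"
  proof (rule rotation_step[OF n, where c = c])
    show "p j = Suc (p i) mod Suc n" by (simp add: j_def p_cyc_next)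
    show "p i \<noteq> p n" "p j \<noteq> p n" "p (Suc i) \<noteq> p 0" "p (Suc j) \<noteq> p 0"
      using rotational_eqD assms by (fastforce simp: j_def)+
  qed (use assms c rotational_le in \<open>auto simp: j_def\<close>)
  moreover have "p 0 \<noteq> Suc (p (Suc i)) mod Suc n"
    using assms p_cyc_next[of "Suc i"] rotational_eqD[of "cyc_next n p (Suc i)" 0] cyc_next_le by auto
  ultimately have "p (Suc j) = p (cyc_next n p (Suc i))"
    by (simp add: p_cyc_next)
  then show ?thesis using rotational_eqD[of "Suc j" "cyc_next n p (Suc i)"] assms cyc_next_le
    by (auto simp: j_def)
qed

lemma p_cyc_next_iterate: "p ((cyc_next n p ^^ k) 0) = (p 0 + k) mod Suc n"
  by (induction k) (use rotational_le[of 0] in \<open>simp_all add: p_cyc_next mod_Suc_eq\<close>)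

lemma cyc_next_reaches:
  assumes "i \<le> n"
  obtains k where "(cyc_next n p ^^ k) 0 = i"
proof
  \<comment> \<open>The cyclic distance from \<open>p 0\<close> to \<open>p i\<close>, with a full
    turn added so that the subtraction cannot truncate.\<close>
  define k where "k = p i + Suc n - p 0"
  have le: "(cyc_next n p ^^ k) 0 \<le> n"
    by (cases k) (auto simp: cyc_next_le)
  have "p 0 + k = p i + Suc n" using rotational_le[of 0] by (simp add: k_def)
  then have "p ((cyc_next n p ^^ k) 0) = p i"
    using rotational_le[OF assms] by (simp add: p_cyc_next_iterate del: add_Suc_right)
  then show "(cyc_next n p ^^ k) 0 = i" using rotational_eqD le assms by blast
qed

lemma cyc_prev_pos: "0 < cyc_prev n p 0"
  using cyc_next_prev[of 0] cyc_next_ne[of 0] by (cases "cyc_prev n p 0") auto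

lemma cyc_next_formula:
  shows "n < cyc_next n p 0 + cyc_prev n p 0"
    and "i \<le> n \<Longrightarrow> cyc_next n p i =
      (if i + cyc_next n p 0 \<le> n then i + cyc_next n p 0
       else if cyc_prev n p 0 \<le> i then i - cyc_prev n p 0
       else i + cyc_next n p 0 - cyc_prev n p 0)"
proof -
  note * = three_gap_successor[of "cyc_next n p" n "cyc_prev n p 0"]
  note prems = cyc_next_inj cyc_next_le cyc_next_Suc cyc_next_prev[of 0] cyc_prev_le cyc_prev_pos
  show "n < cyc_next n p 0 + cyc_prev n p 0"
    by (rule *(1)) (use prems in auto)
  show "cyc_next n p i =
      (if i + cyc_next n p 0 \<le> n then i + cyc_next n p 0
       else if cyc_prev n p 0 \<le> i then i - cyc_prev n p 0
       else i + cyc_next n p 0 - cyc_prev n p 0)" if "i \<le> n"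
    by (rule *(2)) (use prems that in auto)
qed

lemma neighbours_in_coprime_pairs: "(cyc_next n p 0, cyc_prev n p 0) \<in> coprime_pairs n"
proof -
  define u v g where "u = cyc_next n p 0" and "v = cyc_prev n p 0" and "g = gcd u v"
  have uv: "n < u + v" using cyc_next_formula(1) by (simp add: u_def v_def)
  have g: "g dvd u" "g dvd v" by (auto simp: g_def)
  \<comment> \<open>Each branch of \<open>cyc_next_formula\<close> changes the index by
    \<open>u\<close>, \<open>-v\<close> or \<open>u - v\<close>, so the orbit of \<open>0\<close>
    consists of multiples of \<open>g\<close>.\<close>
  have "g dvd (cyc_next n p ^^ k) 0" for k
  proof (induction k)
    case (Suc k)
    let ?i = "(cyc_next n p ^^ k) 0"
    have "?i \<le> n" by (cases k) (auto simp: cyc_next_le)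
    then show ?case using cyc_next_formula(2)[of ?i] Suc g
      by (auto simp: u_def[symmetric] v_def[symmetric] intro!: dvd_diff_nat)
  qed simp
  moreover obtain k where "(cyc_next n p ^^ k) 0 = 1" using cyc_next_reaches n by blast
  ultimately have "g = 1" by (metis dvd_1_iff_1 One_nat_def)
  then have "coprime u v" unfolding g_def coprime_iff_gcd_eq_1 .
  moreover have "0 < u" using cyc_next_ne[of 0] by (simp add: u_def)
  ultimately show ?thesis using uv cyc_next_le[of 0] cyc_prev_le[of 0] cyc_prev_pos
    by (auto simp: coprime_pairs_def u_def v_def)
qed

end

text \<open>The neighbours of index \<open>0\<close> determine \<open>cyc_next\<close>, whose
  iterates from \<open>0\<close> visit every index and place the \<open>k\<close>-th one at
  \<open>p 0 + k\<close> modulo \<open>n + 1\<close>.\<close>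

lemma rotational_eqI:
  assumes n: "n \<ge> 1" and p: "rotational n p" and q: "rotational n q"
    and next_eq: "cyc_next n p 0 = cyc_next n q 0"
    and prev_eq: "cyc_prev n p 0 = cyc_prev n q 0"
    and zero: "p 0 = q 0" and i: "i \<le> n"
  shows "p i = q i"
proof -
  have eq: "cyc_next n p i = cyc_next n q i" if "i \<le> n" for i
    using cyc_next_formula(2)[OF n p that] cyc_next_formula(2)[OF n q that] next_eq prev_eq
    by simp
  have "(cyc_next n p ^^ k) 0 = (cyc_next n q ^^ k) 0 \<and> (cyc_next n p ^^ k) 0 \<le> n" for k
    by (induction k) (use eq cyc_next_le[OF n q] in auto)
  moreover obtain k where "(cyc_next n p ^^ k) 0 = i"
    using cyc_next_reaches[OF n p i] .
  ultimately show ?thesis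
    using p_cyc_next_iterate[OF n p, of k] p_cyc_next_iterate[OF n q, of k] zero by metis
qed

section \<open>Counting \<open>V m\<close>\<close>

lemma V_rotational:
  assumes "m \<ge> 1" and "\<theta> \<in> V m"
  shows "\<theta> 0 = 0" and "rotational m \<theta>"
proof -
  have perm: "\<theta> permutes {1..m}" using assms by (simp add: V_def Sym_def)
  then show 0: "\<theta> 0 = 0" by (simp add: permutes_def)
  have "\<theta> permutes {..m}" by (rule permutes_subset[OF perm]) auto
  then have bij: "bij_betw \<theta> {..m} {..m}" by (rule permutes_imp_bij)
  have pos: "0 < \<theta> i" if "i \<in> {1..m}" for i
    using permutes_in_image[OF perm, of i] that by auto
  \<comment> \<open>The constant is the one forced by \<open>i = 0\<close>; its \<open>- 1\<close>
    is the indicator of \<open>\<theta> 0 \<le> \<theta> (Suc i)\<close>, always \<open>1\<close> as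
    \<open>\<theta> 0 = 0\<close>.\<close>
  have "[int (\<theta> (Suc i)) - of_bool (\<theta> 0 \<le> \<theta> (Suc i))
        = int (\<theta> i) - of_bool (\<theta> m \<le> \<theta> i) + (int (\<theta> 1) - 1)] (mod int m)" if "i < m" for i
  proof (cases "i = 0")
    case True
    then show ?thesis using 0 pos[of m] assms(1) by simp
  next
    case False
    then have "i \<in> {1..m - 1}" using that by auto
    then have "[int (\<theta> (i + 1)) - int (\<theta> i) = int (\<theta> 1) - of_bool (\<theta> m \<le> \<theta> i)] (mod int m)"
      using assms(2) unfolding V_def by blast
    from cong_add[OF this cong_refl, of "int (\<theta> i) - 1"] show ?thesis
      using 0 by (simp add: algebra_simps)
  qed
  then show "rotational m \<theta>" using bij unfolding rotational_def by blast
qed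

lemma card_V_le:
  assumes "m \<ge> 1"
  shows "card (V m) \<le> card (coprime_pairs m)"
proof (rule card_inj_on_le)
  show "inj_on (\<lambda>\<theta>. (cyc_next m \<theta> 0, cyc_prev m \<theta> 0)) (V m)"
  proof (rule inj_onI)
    fix \<theta> \<eta> assume *: "\<theta> \<in> V m" "\<eta> \<in> V m"
      "(cyc_next m \<theta> 0, cyc_prev m \<theta> 0) = (cyc_next m \<eta> 0, cyc_prev m \<eta> 0)"
    show "\<theta> = \<eta>"
    proof
      fix i show "\<theta> i = \<eta> i"
      proof (cases "i \<le> m")
        case True
        then show ?thesis
          using rotational_eqI[OF assms V_rotational(2)[OF assms *(1)]
              V_rotational(2)[OF assms *(2)]] V_rotational(1)[OF assms *(1)]
              V_rotational(1)[OF assms *(2)] *(3) True by simp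
      next
        case False
        then show ?thesis using * by (auto simp: V_def Sym_def permutes_def)
      qed
    qed
  qed
qed (use neighbours_in_coprime_pairs V_rotational assms finite_coprime_pairs in auto)

section \<open>Shift closure of \<open>Y m\<close>\<close>

lemma Sym_range:
  assumes "\<theta> \<in> Sym m" "i \<in> {1..m}"
  shows "1 \<le> \<theta> i" "\<theta> i \<le> m"
  using permutes_in_image[of \<theta> "{1..m}" i] assms by (auto simp: Sym_def)

lemma Sym_inj:
  assumes "\<theta> \<in> Sym m"
  shows "\<theta> i = \<theta> j \<longleftrightarrow> i = j"
  using assms permutes_inj by (auto simp: Sym_def inj_def)

text \<open>At either endpoint the indicators of \<open>\<theta> m \<le> \<theta> i\<close> and
  \<open>\<theta> 1 \<le> \<theta> (i + 1)\<close> must differ, and this orders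
  \<open>\<theta> 1\<close> and \<open>\<theta> m\<close>.\<close>

lemma Delta_bounds:
  assumes "\<theta> \<in> Sym m" and "i \<in> {1..m - 1}"
  shows "- (int m - 1) \<le> Delta m \<theta> i" "Delta m \<theta> i \<le> 0"
    and "Delta m \<theta> i = 0 \<Longrightarrow> \<theta> m < \<theta> 1"
    and "Delta m \<theta> i = - (int m - 1) \<Longrightarrow> \<theta> 1 < \<theta> m"
proof -
  have ne: "\<theta> i \<noteq> \<theta> (i + 1)" "\<theta> i \<noteq> \<theta> m" "\<theta> (i + 1) \<noteq> \<theta> 1" "\<theta> 1 \<noteq> \<theta> m"
    using assms Sym_inj[OF assms(1)] by auto
  have ij: "i \<in> {1..m}" "i + 1 \<in> {1..m}" "1 \<in> {1..m}" "m \<in> {1..m}"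
    using assms(2) by auto
  have range: "1 \<le> \<theta> i" "\<theta> i \<le> m" "1 \<le> \<theta> (i + 1)" "\<theta> (i + 1) \<le> m"
    "1 \<le> \<theta> 1" "\<theta> 1 \<le> m" "1 \<le> \<theta> m" "\<theta> m \<le> m"
    using ij Sym_range[OF assms(1)] by blast+
  have "- (int m - 1) \<le> Delta m \<theta> i \<and> Delta m \<theta> i \<le> 0
    \<and> (Delta m \<theta> i = 0 \<longrightarrow> \<theta> m < \<theta> 1) \<and> (Delta m \<theta> i = - (int m - 1) \<longrightarrow> \<theta> 1 < \<theta> m)"
    unfolding Delta_def of_bool_def
    by (cases "\<theta> m \<le> \<theta> i"; cases "\<theta> 1 \<le> \<theta> (i + 1)"; cases "\<theta> i \<le> \<theta> (i + 1)";
        simp only: if_True if_False mult_1_right mult_zero_right;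
        use ne range in linarith)
  then show "- (int m - 1) \<le> Delta m \<theta> i" "Delta m \<theta> i \<le> 0"
    "Delta m \<theta> i = 0 \<Longrightarrow> \<theta> m < \<theta> 1" "Delta m \<theta> i = - (int m - 1) \<Longrightarrow> \<theta> 1 < \<theta> m"
    by auto
qed

text \<open>
  \<open>Delta\<close> takes values in an interval of length \<open>m - 1\<close>, so only its two endpoints can be confused
  modulo \<open>m - 1\<close>; they force opposite orders of \<open>\<theta> 1\<close> and \<open>\<theta> m\<close> and hence do not both occur.
\<close>

lemma Y_iff_cong:
  assumes "\<theta> \<in> Sym m" "m \<ge> 2"
  shows "\<theta> \<in> Y m \<longleftrightarrow> (\<exists>c. \<forall>i\<in>{1..m - 1}. [Delta m \<theta> i = c] (mod (int m - 1)))"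
proof
  assume Y: "\<theta> \<in> Y m"
  have "Delta m \<theta> i = Delta m \<theta> 1" if "1 \<le> i" "i \<le> m - 1" for i
    using that
  proof (induction i rule: dec_induct)
    case (step i)
    then have "i \<in> {1..m - 2}" by auto
    then have "Delta m \<theta> (i + 1) - Delta m \<theta> i = 0" using Y unfolding Y_def by blast
    then show ?case using step by simp
  qed simp
  then have "\<forall>i\<in>{1..m - 1}. [Delta m \<theta> i = Delta m \<theta> 1] (mod (int m - 1))"
    by (metis atLeastAtMost_iff cong_refl)
  then show "\<exists>c. \<forall>i\<in>{1..m - 1}. [Delta m \<theta> i = c] (mod (int m - 1))" ..
next
  assume "\<exists>c. \<forall>i\<in>{1..m - 1}. [Delta m \<theta> i = c] (mod (int m - 1))"
  then obtain c where c: "\<And>i. i \<in> {1..m - 1} \<Longrightarrow> [Delta m \<theta> i = c] (mod (int m - 1))"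
    by blast
  have "Delta m \<theta> (i + 1) = Delta m \<theta> i" if "i \<in> {1..m - 2}" for i
  proof (rule ccontr)
    assume ne: "Delta m \<theta> (i + 1) \<noteq> Delta m \<theta> i"
    have i: "i \<in> {1..m - 1}" "i + 1 \<in> {1..m - 1}" using that by auto
    have "[Delta m \<theta> (i + 1) = Delta m \<theta> i] (mod (int m - 1))"
      using c i by (meson cong_sym cong_trans)
    then have "(int m - 1) dvd (Delta m \<theta> (i + 1) - Delta m \<theta> i)"
      by (simp add: cong_iff_dvd_diff)
    then have "int m - 1 \<le> \<bar>Delta m \<theta> (i + 1) - Delta m \<theta> i\<bar>"
      using dvd_imp_le_int[of "Delta m \<theta> (i + 1) - Delta m \<theta> i" "int m - 1"] ne assms by auto
    then show False
      using Delta_bounds[OF assms(1) i(1)] Delta_bounds[OF assms(1) i(2)] by linarith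
  qed
  then show "\<theta> \<in> Y m" using assms by (auto simp: Y_def)
qed

lemma shift_equiv_value:
  assumes "\<theta> \<in> Sym m" "\<theta>' \<in> Sym m" "k \<in> {1..m}" "i \<in> {1..m}"
    and "[\<theta>' i = \<theta> i + k] (mod m)"
  shows "int (\<theta>' i) = int (\<theta> i) + int k - int m * of_bool (m < \<theta> i + k)"
proof -
  have r: "1 \<le> \<theta> i" "\<theta> i \<le> m" "1 \<le> \<theta>' i" "\<theta>' i \<le> m"
    using assms Sym_range by blast+
  define t where "t = (if m < \<theta> i + k then \<theta> i + k - m else \<theta> i + k)"
  have t: "1 \<le> t" "t \<le> m" "[t = \<theta> i + k] (mod m)"
    using r assms(3) by (auto simp: t_def cong_def mod_if)
  \<comment> \<open>Both values lie in \<open>{1..m}\<close>; lowering them by \<open>1\<close>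
    gives least residues, for which congruence is equality.\<close>
  have "[\<theta>' i - 1 = t - 1] (mod m)"
    using assms(5) t r by (meson cong_diff_nat cong_refl cong_sym cong_trans)
  then have "\<theta>' i - 1 = t - 1"
    by (rule cong_less_modulus_unique_nat) (use r t in auto)
  then show ?thesis using r t by (auto simp: t_def split: if_splits)
qed

lemma shift_closure_Y:
  assumes "m \<ge> 2"
  shows "shift_closure m (Y m) = Y m"
proof (intro equalityI subsetI)
  fix \<theta> assume "\<theta> \<in> Y m"
  \<comment> \<open>The trivial shift is \<open>k = m\<close>, since \<open>k\<close> ranges over
    \<open>{1..m}\<close>.\<close>
  moreover have "shift_equiv m \<theta> \<theta>"
    unfolding shift_equiv_def using assms by (intro bexI[of _ m]) (auto simp: cong_def)
  ultimately show "\<theta> \<in> shift_closure m (Y m)" by (auto simp: shift_closure_def Y_def)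
next
  fix \<theta>' assume "\<theta>' \<in> shift_closure m (Y m)"
  then obtain \<theta> k where \<theta>': "\<theta>' \<in> Sym m" and Y: "\<theta> \<in> Y m" and k: "k \<in> {1..m}"
    and shift: "\<And>i. i \<in> {1..m} \<Longrightarrow> [\<theta>' i = \<theta> i + k] (mod m)"
    by (auto simp: shift_closure_def shift_equiv_def)
  have \<theta>: "\<theta> \<in> Sym m" using Y by (simp add: Y_def)
  obtain c where c: "\<And>i. i \<in> {1..m - 1} \<Longrightarrow> [Delta m \<theta> i = c] (mod (int m - 1))"
    using Y Y_iff_cong[OF \<theta> assms] by blast
  define wraps :: "nat \<Rightarrow> int" where "wraps i = of_bool (m < \<theta> i + k)" for i
  have val: "int (\<theta>' i) = int (\<theta> i) + int k - int m * wraps i" if "i \<in> {1..m}" for i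
    unfolding wraps_def using shift_equiv_value[OF \<theta> \<theta>' k that shift[OF that]] .
  \<comment> \<open>A shift reverses order only between a wrapped and an unwrapped value, so the
    indicator changes by \<open>wraps j - wraps i\<close>. Modulo \<open>m - 1\<close> the total
    correction no longer depends on \<open>i\<close>, and \<open>j\<close> will be \<open>m\<close>
    or \<open>1\<close>.\<close>
  have gap: "int (\<theta>' i) - of_bool (\<theta>' j \<le> \<theta>' i)
      = int (\<theta> i) - of_bool (\<theta> j \<le> \<theta> i) + int k - wraps j - (int m - 1) * wraps i"
    if ij: "i \<in> {1..m}" "j \<in> {1..m}" for i j
    using val[OF ij(1)] val[OF ij(2)] Sym_range[OF \<theta> ij(1)] Sym_range[OF \<theta> ij(2)] k
    by (auto simp: wraps_def algebra_simps of_bool_def split: if_splits)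
  have "[Delta m \<theta>' i = c + wraps m - wraps 1] (mod (int m - 1))" if i: "i \<in> {1..m - 1}" for i
  proof -
    have ij: "i \<in> {1..m}" "i + 1 \<in> {1..m}" "1 \<in> {1..m}" "m \<in> {1..m}"
      using i by auto
    have "Delta m \<theta>' i = Delta m \<theta> i + wraps m - wraps 1
        + (int m - 1) * (wraps i - wraps (i + 1) + of_bool (\<theta> i \<le> \<theta> (i + 1))
            - of_bool (\<theta>' i \<le> \<theta>' (i + 1)))"
      using gap[OF ij(1) ij(4)] gap[OF ij(2) ij(3)] unfolding Delta_def
      by (simp add: algebra_simps)
    then have "[Delta m \<theta>' i = Delta m \<theta> i + wraps m - wraps 1] (mod (int m - 1))"
      by (simp add: cong_iff_dvd_diff)
    also have "[Delta m \<theta> i + wraps m - wraps 1 = c + wraps m - wraps 1] (mod (int m - 1))"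
      by (intro cong_add cong_diff cong_refl c i)
    finally show ?thesis .
  qed
  then show "\<theta>' \<in> Y m" using Y_iff_cong[OF \<theta>' assms] by blast
qed

section \<open>Counting \<open>Y m\<close>\<close>

definition pred_shift :: "(nat \<Rightarrow> nat) \<Rightarrow> nat \<Rightarrow> nat" where
  "pred_shift \<theta> i = \<theta> (Suc i) - 1"

text \<open>Modulo \<open>m - 1\<close> the last term of \<open>Delta\<close> vanishes; what remains
  is the rotation condition with deleted points \<open>\<theta> m\<close> and
  \<open>\<theta> 1\<close>.\<close>

lemma Y_rotational:
  assumes "m \<ge> 2" "\<theta> \<in> Y m"
  shows "rotational (m - 1) (pred_shift \<theta>)"
proof -
  have \<theta>: "\<theta> \<in> Sym m" using assms by (simp add: Y_def)
  have val: "int (pred_shift \<theta> i) = int (\<theta> (Suc i)) - 1" if "i < m" for i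
    using Sym_range(1)[OF \<theta>, of "Suc i"] that by (auto simp: pred_shift_def)
  have le: "pred_shift \<theta> i \<le> pred_shift \<theta> j \<longleftrightarrow> \<theta> (Suc i) \<le> \<theta> (Suc j)" if "i < m" "j < m" for i j
    using val[OF that(1)] val[OF that(2)] by linarith
  obtain c where c: "\<And>i. i \<in> {1..m - 1} \<Longrightarrow> [Delta m \<theta> i = c] (mod (int m - 1))"
    using assms Y_iff_cong[OF \<theta> assms(1)] by blast
  have "inj_on (pred_shift \<theta>) {..m - 1}"
  proof (rule inj_onI)
    fix i j assume "i \<in> {..m - 1}" "j \<in> {..m - 1}" "pred_shift \<theta> i = pred_shift \<theta> j"
    then have "\<theta> (Suc i) = \<theta> (Suc j)" using val[of i] val[of j] assms(1) by simp
    then show "i = j" using Sym_inj[OF \<theta>] by simp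
  qed
  moreover have "pred_shift \<theta> ` {..m - 1} \<subseteq> {..m - 1}"
  proof (rule image_subsetI)
    fix i assume "i \<in> {..m - 1}"
    then have "\<theta> (Suc i) \<le> m" using Sym_range(2)[OF \<theta>, of "Suc i"] assms(1) by auto
    then show "pred_shift \<theta> i \<in> {..m - 1}" by (auto simp: pred_shift_def)
  qed
  ultimately have bij: "bij_betw (pred_shift \<theta>) {..m - 1} {..m - 1}"
    unfolding bij_betw_def by (simp add: endo_inj_surj)
  have "[int (pred_shift \<theta> (Suc i)) - of_bool (pred_shift \<theta> 0 \<le> pred_shift \<theta> (Suc i))
      = int (pred_shift \<theta> i) - of_bool (pred_shift \<theta> (m - 1) \<le> pred_shift \<theta> i) + c]
      (mod int (m - 1))" if i: "i < m - 1" for i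
  proof -
    have lt: "i < m" "Suc i < m" "0 < m" "m - 1 < m" "Suc (m - 1) = m" using i by auto
    have "[Delta m \<theta> (Suc i) = c] (mod (int m - 1))" using c i by auto
    then obtain t where "Delta m \<theta> (Suc i) = c + (int m - 1) * t"
      by (metis cong_iff_lin cong_sym)
    then have "int (pred_shift \<theta> (Suc i)) - of_bool (pred_shift \<theta> 0 \<le> pred_shift \<theta> (Suc i))
      = int (pred_shift \<theta> i) - of_bool (pred_shift \<theta> (m - 1) \<le> pred_shift \<theta> i) + c
        + (int m - 1) * (t + of_bool (\<theta> (Suc i) \<le> \<theta> (Suc i + 1)))"
      unfolding le[OF lt(3,2)] le[OF lt(4,1)] val[OF lt(1)] val[OF lt(2)] lt(5)
      by (simp add: Delta_def algebra_simps)
    then show ?thesis using assms(1) by (simp add: cong_iff_dvd_diff of_nat_diff)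
  qed
  then show ?thesis using bij unfolding rotational_def by blast
qed

text \<open>The position of the first point is not fixed here, so \<open>\<theta> 1\<close> is
  recorded along with the neighbours; this gives the factor \<open>m\<close>.\<close>

lemma card_Y_le:
  assumes "m \<ge> 2"
  shows "card (Y m) \<le> m * card (coprime_pairs (m - 1))"
proof -
  let ?f = "\<lambda>\<theta>. (\<theta> 1, cyc_next (m - 1) (pred_shift \<theta>) 0, cyc_prev (m - 1) (pred_shift \<theta>) 0)"
  have m1: "m - 1 \<ge> 1" using assms by simp
  have Sym: "\<theta> \<in> Sym m" if "\<theta> \<in> Y m" for \<theta> using that by (simp add: Y_def)
  have "card (Y m) \<le> card ({1..m} \<times> coprime_pairs (m - 1))"
  proof (rule card_inj_on_le)
    show "inj_on ?f (Y m)"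
    proof (rule inj_onI)
      fix \<theta> \<eta> assume *: "\<theta> \<in> Y m" "\<eta> \<in> Y m" "?f \<theta> = ?f \<eta>"
      have pred: "pred_shift \<theta> i = pred_shift \<eta> i" if "i \<le> m - 1" for i
        using rotational_eqI[OF m1 Y_rotational[OF assms *(1)] Y_rotational[OF assms *(2)]] * that
        by (auto simp: pred_shift_def[of _ 0])
      show "\<theta> = \<eta>"
      proof
        fix i show "\<theta> i = \<eta> i"
        proof (cases "i \<in> {1..m}")
          case True
          then have "\<theta> i - 1 = \<eta> i - 1" using pred[of "i - 1"] by (auto simp: pred_shift_def)
          then show ?thesis
            using Sym_range(1)[OF Sym[OF *(1)] True] Sym_range(1)[OF Sym[OF *(2)] True]
            by linarith
        next
          case False
          then show ?thesis using Sym[OF *(1)] Sym[OF *(2)] unfolding Sym_def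
            by (metis mem_Collect_eq permutes_not_in)
        qed
      qed
    qed
    show "?f ` Y m \<subseteq> {1..m} \<times> coprime_pairs (m - 1)"
    proof (rule image_subsetI)
      fix \<theta> assume "\<theta> \<in> Y m"
      then show "?f \<theta> \<in> {1..m} \<times> coprime_pairs (m - 1)"
        using Sym_range[OF Sym, of \<theta> 1] assms
          neighbours_in_coprime_pairs[OF m1 Y_rotational[OF assms]] by auto
    qed
  qed (simp add: finite_coprime_pairs)
  then show ?thesis by (simp add: card_cartesian_product)
qed

theorem theorem2:
  fixes m :: nat
  assumes "m \<ge> 2"
  shows "card (V m) \<le> (\<Sum>k=1..m. totient k)
    \<and> card (Y m) = card (shift_closure m (Y m))
    \<and> card (shift_closure m (Y m)) \<le> m * (\<Sum>k=1..m - 1. totient k)"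
  using card_V_le[of m] card_Y_le[of m] card_coprime_pairs[of m] card_coprime_pairs[of "m - 1"]
    shift_closure_Y[of m] assms by simp

end
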